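(* Let $H=\mathbb C[S_3]$, where $S_3$ is generated by $u,v$ with $u^2=v^2=e$, $uvu=vuv$, with the bicovariant calculus given by the conjugacy class $\mathcal C=\{u,v,uvu\}$. For the framing by the Maurer–Cartan form, the moduli space of zero-torsion spin connections is 12-dimensional and consists of those of the form $$A_u=(\alpha+1)E_u+\gamma E_v+\beta E_{uvu},\qquad A_v=\gamma E_u+(\beta+1)E_v+\alpha E_{uvu},$$ $$A_{uvu}=\beta E_u+\alpha E_v+(\gamma+1)E_{uvu},\qquad \alpha+\beta+\gamma=-1,$$ where $\alpha,\beta,\gamma\in\mathbb C[S_3]$ are functions subject to the constraint shown. They obey $\sum_aA_a=0$.
   Context: $\mathbb C[S_3]$ is the algebra of complex functions on $S_3$, $R_a(f)=f((\ )a)$. The calculus: $\Omega^1(H)$ is the free left $H$-module with basis $\{E_a\}_{a\in\mathcal C}$ (the components of the Maurer–Cartan form), with $E_af=R_a(f)E_a$ and $\mathrm df=\sum_a(R_a(f)-f)E_a$. $\Omega^2(H)=\Omega^1(H)\otimes_H\Omega^1(H)/\ker(\mathrm{id}-\Psi)$ with $\Psi(E_a\otimes_HE_b)=E_{aba^{-1}}\otimes_HE_a$; explicitly $E_a\wedge E_a=0$, $E_u\wedge E_v+E_v\wedge E_{uvu}+E_{uvu}\wedge E_u=0$ and $E_v\wedge E_u+E_{uvu}\wedge E_v+E_u\wedge E_{uvu}=0$. The exterior derivative satisfies $\mathrm dE_a=\sum_b(E_a\wedge E_b+E_b\wedge E_a)$. A spin connection is a collection $\{A_a\}_{a\in\mathcal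 C}$ of 1-forms. It has zero torsion (for the framing $\{E_a\}$) if $\mathrm dE_a+\sum_{b\in\mathcal C}A_b\wedge(E_{b^{-1}ab}-E_a)=0$ for all $a\in\mathcal C$. Dimension is over $\mathbb C$. *)

theory Defs
  imports
    Complex_Main
    "HOL-Combinatorics.Perm"
    "HOL-Library.Numeral_Type"
    "HOL-Library.Function_Algebras"
    "HOL-Library.Set_Algebras"
begin

text \<open>
  The group \<open>S\<^sub>3\<close> is the type of permutations of the three-element type \<open>3\<close>, with
  composition as product. All sums and products of functions are pointwise
  (theory \<open>Function_Algebras\<close>), so the type \<open>H\<close> is the algebra of complex functions on the group.
\<close>

type_synonym S3 = "3 perm"
type_synonym H = "S3 \<Rightarrow> complex"

definition is_subgroup :: "S3 set \<Rightarrow> bool" where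
  "is_subgroup K \<longleftrightarrow> 1 \<in> K \<and> (\<forall>x\<in>K. \<forall>y\<in>K. x * y \<in> K) \<and> (\<forall>x\<in>K. inverse x \<in> K)"

definition generates_S3 :: "S3 set \<Rightarrow> bool" where
  "generates_S3 X \<longleftrightarrow> is_subgroup hull X = UNIV"

definition R :: "S3 \<Rightarrow> H \<Rightarrow> H" where
  "R a f = (\<lambda>g. f (g * a))"


subsection \<open>One-forms\<close>

text \<open>
  The 1-form \<open>\<Sum>a\<in>C. f\<^sub>a E\<^sub>a\<close> is represented by its family of coefficients
  \<open>a \<mapsto> f\<^sub>a\<close>, extended by \<open>0\<close> outside \<open>C\<close>.
\<close>

type_synonym form1 = "S3 \<Rightarrow> H"

definition Omega1 :: "S3 set \<Rightarrow> form1 set" where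
  "Omega1 C = {\<omega>. \<forall>a. a \<notin> C \<longrightarrow> \<omega> a = 0}"

definition E :: "S3 \<Rightarrow> form1" where
  "E a = (\<lambda>b. if b = a then 1 else 0)"

definition lmul :: "H \<Rightarrow> ('i \<Rightarrow> H) \<Rightarrow> ('i \<Rightarrow> H)"  (infixr "\<cdot>" 75) where
  "f \<cdot> \<omega> = (\<lambda>i. f * \<omega> i)"

text \<open>The right module structure comes from \<open>E\<^sub>a f = R\<^sub>a(f) E\<^sub>a\<close>; see \<open>E_commute\<close>.\<close>

definition rmul :: "form1 \<Rightarrow> H \<Rightarrow> form1" where
  "rmul \<omega> f = (\<lambda>a. \<omega> a * R a f)"

definition d0 :: "S3 set \<Rightarrow> H \<Rightarrow> form1" where
  "d0 C f = (\<Sum>a\<in>C. (R a f - f) \<cdot> E a)"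


subsection \<open>The tensor product over \<open>H\<close> and two-forms\<close>

text \<open>
  \<open>\<Omega>\<^sup>1 \<otimes>\<^sub>H \<Omega>\<^sup>1\<close> is the free left \<open>H\<close>-module on the \<open>E\<^sub>a \<otimes> E\<^sub>b\<close> with \<open>a, b \<in> C\<close>, and
  \<open>(f E\<^sub>a) \<otimes> (g E\<^sub>b) = f R\<^sub>a(g) E\<^sub>a \<otimes> E\<^sub>b\<close>. Elements are again represented by their
  coefficients. The lemmas \<open>tensor_balanced\<close> and \<open>tensor_universal\<close> show that this is the
  tensor product over \<open>H\<close>.
\<close>

type_synonym tens = "S3 \<times> S3 \<Rightarrow> H"

definition Tensor2 :: "S3 set \<Rightarrow> tens set" where
  "Tensor2 C = {t. \<forall>p. p \<notin> C \<times> C \<longrightarrow> t p = 0}"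

definition tensor :: "form1 \<Rightarrow> form1 \<Rightarrow> tens"  (infixl "\<otimes>\<^sub>H" 72) where
  "\<omega> \<otimes>\<^sub>H \<eta> = (\<lambda>(a, b). \<omega> a * R a (\<eta> b))"

text \<open>The braiding is the left \<open>H\<close>-linear extension of its values on the basis.\<close>

definition Psi :: "S3 set \<Rightarrow> tens \<Rightarrow> tens" where
  "Psi C t = (\<Sum>(a, b)\<in>C \<times> C. t (a, b) \<cdot> (E (a * b * inverse a) \<otimes>\<^sub>H E a))"

definition ker_id_minus_Psi :: "S3 set \<Rightarrow> tens set" where
  "ker_id_minus_Psi C = {t \<in> Tensor2 C. t - Psi C t = 0}"

definition rel2 :: "S3 set \<Rightarrow> (tens \<times> tens) set" where
  "rel2 C = {(s, t). s \<in> Tensor2 C \<and> t \<in> Tensor2 C \<and> s - t \<in> ker_id_minus_Psi C}"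

text \<open>
  Two-forms are cosets of \<open>ker_id_minus_Psi C\<close>. They are added as cosets, by the elementwise
  sum of sets (theory \<open>Set_Algebras\<close>). The zero of \<open>Omega2 C\<close> is the coset \<open>zero2 C\<close>,
  not the set-theoretic zero \<open>{0}\<close>.
\<close>

type_synonym form2 = "tens set"

definition Omega2 :: "S3 set \<Rightarrow> form2 set" where
  "Omega2 C = Tensor2 C // rel2 C"

definition class2 :: "S3 set \<Rightarrow> tens \<Rightarrow> form2" where
  "class2 C t = rel2 C `` {t}"

definition zero2 :: "S3 set \<Rightarrow> form2" where
  "zero2 C = class2 C 0"

definition wedge :: "S3 set \<Rightarrow> form1 \<Rightarrow> form1 \<Rightarrow> form2" where
  "wedge C \<omega> \<eta> = class2 C (\<omega> \<otimes>\<^sub>H \<eta>)"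

text \<open>
  The exterior derivative of \<open>\<omega> = \<Sum>a\<in>C. \<omega>\<^sub>a E\<^sub>a\<close> is \<open>\<Sum>a\<in>C. d\<omega>\<^sub>a \<and> E\<^sub>a + \<omega>\<^sub>a dE\<^sub>a\<close> with
  \<open>dE\<^sub>a = \<Sum>b\<in>C. E\<^sub>a \<and> E\<^sub>b + E\<^sub>b \<and> E\<^sub>a\<close>; see \<open>d1_E\<close>.
\<close>

definition d1 :: "S3 set \<Rightarrow> form1 \<Rightarrow> form2" where
  "d1 C \<omega> = class2 C (\<Sum>a\<in>C. d0 C (\<omega> a) \<otimes>\<^sub>H E a
      + \<omega> a \<cdot> (\<Sum>b\<in>C. E a \<otimes>\<^sub>H E b + E b \<otimes>\<^sub>H E a))"


subsection \<open>Spin connections\<close>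

text \<open>
  A collection \<open>{A\<^sub>a}\<close> indexed by \<open>a \<in> C\<close> is a function extended by \<open>0\<close> outside \<open>C\<close>, so that
  the collections form a complex vector space.
\<close>

definition spin_connections :: "S3 set \<Rightarrow> (S3 \<Rightarrow> form1) set" where
  "spin_connections C = {A. (\<forall>a\<in>C. A a \<in> Omega1 C) \<and> (\<forall>a. a \<notin> C \<longrightarrow> A a = 0)}"

definition torsion :: "S3 set \<Rightarrow> (S3 \<Rightarrow> form1) \<Rightarrow> S3 \<Rightarrow> form2" where
  "torsion C A a = d1 C (E a) + (\<Sum>b\<in>C. wedge C (A b) (E (inverse b * a * b) - E a))"

definition zero_torsion :: "S3 set \<Rightarrow> (S3 \<Rightarrow> form1) \<Rightarrow> bool" where
  "zero_torsion C A \<longleftrightarrow> (\<forall>a\<in>C. torsion C A a = zero2 C)"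

definition torsion_free_connections :: "S3 set \<Rightarrow> (S3 \<Rightarrow> form1) set" where
  "torsion_free_connections C = {A \<in> spin_connections C. zero_torsion C A}"


subsection \<open>Complex dimension\<close>

definition scaleC_conn :: "complex \<Rightarrow> (S3 \<Rightarrow> form1) \<Rightarrow> (S3 \<Rightarrow> form1)" where
  "scaleC_conn c A = (\<lambda>a b g. c * A a b g)"

global_interpretation conn: vector_space scaleC_conn
  defines conn_subspace = conn.subspace
    and conn_span = conn.span
    and conn_dim = conn.dim
  by unfold_locales (auto simp: scaleC_conn_def algebra_simps fun_eq_iff)

text \<open>The zero-torsion condition is inhomogeneous, so the moduli space is an affine space.\<close>

definition complex_affine_dim :: "(S3 \<Rightarrow> form1) set \<Rightarrow> nat \<Rightarrow> bool" where
  "complex_affine_dim S n \<longleftrightarrow>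
     (\<exists>p V. conn.subspace V \<and> conn.dim V = n \<and> S = {p + A | A. A \<in> V})"


subsection \<open>Basic facts\<close>

lemma perm_mult_inverse_cancel [simp]:
  "(x::S3) * (inverse x * y) = y" "inverse x * (x * y) = (y::S3)"
  by (simp_all add: mult.assoc[symmetric])

lemma conjugacy_class:
  fixes u v :: S3
  assumes uu: "u * u = 1" and vv: "v * v = 1" and br: "u * v * u = v * u * v"
    and gen: "generates_S3 {u, v}"
  shows "{g * u * inverse g | g. True} = {u, v, u * v * u}" (is "?L = ?C")
proof -
  have iu: "inverse u = u" and iv: "inverse v = v"
    using perm_mult_inverse_cancel(2)[of u u] perm_mult_inverse_cancel(2)[of v v] uu vv by auto
  have u2: "u * (u * x) = x" and v2: "v * (v * x) = x" for x
    using uu vv by (simp_all add: mult.assoc[symmetric])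
  have br': "u * (v * u) = v * (u * v)" using br by (simp add: mult.assoc)
  define K where "K = {g :: S3. (\<lambda>x. g * x * inverse g) ` ?C \<subseteq> ?C}"
  have "is_subgroup K"
    unfolding is_subgroup_def
  proof (intro conjI ballI)
    show "1 \<in> K" by (simp add: K_def)
  next
    fix x y assume xy: "x \<in> K" "y \<in> K"
    have "x * y * c * inverse (x * y) = x * (y * c * inverse y) * inverse x" for c
      by (simp add: mult.assoc)
    then show "x * y \<in> K" using xy unfolding K_def by (simp only: mem_Collect_eq) blast
  next
    fix x assume x: "x \<in> K"
    have "inj_on (\<lambda>c. x * c * inverse x) ?C"
    proof (rule inj_onI)
      fix c d assume "x * c * inverse x = x * d * inverse x"
      then have "inverse x * (x * c * inverse x) * x = inverse x * (x * d * inverse x) * x" by simp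
      then show "c = d" by (simp add: mult.assoc)
    qed
    then have "(\<lambda>c. x * c * inverse x) ` ?C = ?C"
      using x by (intro endo_inj_surj) (auto simp: K_def)
    moreover have "inverse x * (x * c * inverse x) * inverse (inverse x) = c" for c
      by (simp add: mult.assoc)
    ultimately have "inverse x * c * inverse (inverse x) \<in> ?C" if "c \<in> ?C" for c
      using that by (metis (no_types, lifting) imageE)
    then show "inverse x \<in> K" by (auto simp only: K_def)
  qed
  moreover have "u \<in> K" "v \<in> K"
    using br' by (auto simp: K_def iu iv uu vv u2 v2 mult.assoc)
  ultimately have "UNIV \<subseteq> K"
    using gen hull_minimal[of "{u, v}" K is_subgroup] by (simp add: generates_S3_def)
  then have "?L \<subseteq> ?C" by (auto simp only: K_def)
  moreover have "?C \<subseteq> ?L"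
  proof -
    have "u = 1 * u * inverse 1" by simp
    moreover have "v = (u * v) * u * inverse (u * v)"
      using br' by (simp add: iu iv mult.assoc u2 v2 uu vv)
    moreover have "u * v * u = v * u * inverse v"
      using br by (simp add: iv)
    ultimately show ?thesis by blast
  qed
  ultimately show ?thesis by blast
qed

lemma E_commute: "rmul (E a) f = R a f \<cdot> E a"
  by (auto simp: rmul_def E_def lmul_def fun_eq_iff)

lemma tensor_balanced: "rmul \<omega> f \<otimes>\<^sub>H \<eta> = \<omega> \<otimes>\<^sub>H (f \<cdot> \<eta>)"
  by (auto simp: rmul_def tensor_def lmul_def R_def fun_eq_iff)

lemma sum_fun_apply: "(\<Sum>i\<in>I. f i) x = (\<Sum>i\<in>I. f i x)"
  for f :: "'i \<Rightarrow> 'a \<Rightarrow> 'b::comm_monoid_add"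
  by (induction I rule: infinite_finite_induct) auto

lemma form1_basis:
  assumes "finite C" "\<omega> \<in> Omega1 C"
  shows "\<omega> = (\<Sum>a\<in>C. \<omega> a \<cdot> E a)"
proof
  fix b
  have "(\<Sum>a\<in>C. \<omega> a \<cdot> E a) b = (\<Sum>a\<in>C. if a = b then \<omega> a else 0)"
    by (auto simp: sum_fun_apply lmul_def E_def intro!: sum.cong)
  then show "\<omega> b = (\<Sum>a\<in>C. \<omega> a \<cdot> E a) b"
    using assms by (auto simp: Omega1_def)
qed

lemma tensor_basis:
  assumes "finite C" "t \<in> Tensor2 C"
  shows "t = (\<Sum>(a, b)\<in>C \<times> C. (t (a, b) \<cdot> E a) \<otimes>\<^sub>H E b)"
proof
  fix p :: "S3 \<times> S3"
  have "(\<Sum>(a, b)\<in>C \<times> C. (t (a, b) \<cdot> E a) \<otimes>\<^sub>H E b) p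
      = (\<Sum>q\<in>C \<times> C. if q = p then t q else 0)"
    by (cases p) (auto simp: sum_fun_apply lmul_def E_def tensor_def R_def fun_eq_iff
        intro!: sum.cong split: if_splits)
  then show "t p = (\<Sum>(a, b)\<in>C \<times> C. (t (a, b) \<cdot> E a) \<otimes>\<^sub>H E b) p"
    using assms by (cases "p \<in> C \<times> C")
      (auto simp: Tensor2_def simp del: mem_Sigma_iff split_paired_All)
qed

lemma lmul_E_Omega1: "a \<in> C \<Longrightarrow> f \<cdot> E a \<in> Omega1 C"
  by (auto simp: Omega1_def lmul_def E_def)

lemma E_Omega1: "a \<in> C \<Longrightarrow> E a \<in> Omega1 C"
  by (auto simp: Omega1_def E_def)

lemma Omega1_add: "\<omega> \<in> Omega1 C \<Longrightarrow> \<eta> \<in> Omega1 C \<Longrightarrow> \<omega> + \<eta> \<in> Omega1 C"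
  by (auto simp: Omega1_def)

lemma Tensor2_add: "s \<in> Tensor2 C \<Longrightarrow> t \<in> Tensor2 C \<Longrightarrow> s + t \<in> Tensor2 C"
  by (auto simp: Tensor2_def)

lemma zero_Tensor2: "0 \<in> Tensor2 C"
  by (simp add: Tensor2_def)

lemma tensor_Tensor2: "\<omega> \<in> Omega1 C \<Longrightarrow> \<eta> \<in> Omega1 C \<Longrightarrow> \<omega> \<otimes>\<^sub>H \<eta> \<in> Tensor2 C"
  by (auto simp: Tensor2_def Omega1_def tensor_def R_def fun_eq_iff)

lemma additive_on_sum:
  fixes F :: "'a::comm_monoid_add \<Rightarrow> 'm::ab_group_add"
  assumes add: "\<And>x y. x \<in> S \<Longrightarrow> y \<in> S \<Longrightarrow> F (x + y) = F x + F y"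
    and closed: "\<And>x y. x \<in> S \<Longrightarrow> y \<in> S \<Longrightarrow> x + y \<in> S" and "0 \<in> S"
    and "\<And>i. i \<in> I \<Longrightarrow> g i \<in> S"
  shows "F (\<Sum>i\<in>I. g i) = (\<Sum>i\<in>I. F (g i))"
proof -
  have F0: "F 0 = 0" using add[OF \<open>0 \<in> S\<close> \<open>0 \<in> S\<close>] by simp
  from assms(4) have "sum g I \<in> S \<and> F (sum g I) = (\<Sum>i\<in>I. F (g i))"
    by (induction I rule: infinite_finite_induct) (auto simp: F0 add closed \<open>0 \<in> S\<close>)
  then show ?thesis ..
qed

lemma tensor_universal:
  fixes \<phi> :: "form1 \<Rightarrow> form1 \<Rightarrow> 'm::ab_group_add"
  assumes fin: "finite C"
    and addl: "\<And>\<omega> \<omega>' \<eta>. \<lbrakk>\<omega> \<in> Omega1 C; \<omega>' \<in> Omega1 C; \<eta> \<in> Omega1 C\<rbrakk>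
                 \<Longrightarrow> \<phi> (\<omega> + \<omega>') \<eta> = \<phi> \<omega> \<eta> + \<phi> \<omega>' \<eta>"
    and addr: "\<And>\<omega> \<eta> \<eta>'. \<lbrakk>\<omega> \<in> Omega1 C; \<eta> \<in> Omega1 C; \<eta>' \<in> Omega1 C\<rbrakk>
                 \<Longrightarrow> \<phi> \<omega> (\<eta> + \<eta>') = \<phi> \<omega> \<eta> + \<phi> \<omega> \<eta>'"
    and bal: "\<And>\<omega> f \<eta>. \<lbrakk>\<omega> \<in> Omega1 C; \<eta> \<in> Omega1 C\<rbrakk> \<Longrightarrow> \<phi> (rmul \<omega> f) \<eta> = \<phi> \<omega> (f \<cdot> \<eta>)"
  shows "\<exists>\<psi>. (\<forall>s\<in>Tensor2 C. \<forall>t\<in>Tensor2 C. \<psi> (s + t) = \<psi> s + \<psi> t)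
           \<and> (\<forall>\<omega>\<in>Omega1 C. \<forall>\<eta>\<in>Omega1 C. \<psi> (\<omega> \<otimes>\<^sub>H \<eta>) = \<phi> \<omega> \<eta>)" (is ?ex)
    and "\<lbrakk>\<And>s t. \<lbrakk>s \<in> Tensor2 C; t \<in> Tensor2 C\<rbrakk> \<Longrightarrow> \<psi> (s + t) = \<psi> s + \<psi> t;
          \<And>\<omega> \<eta>. \<lbrakk>\<omega> \<in> Omega1 C; \<eta> \<in> Omega1 C\<rbrakk> \<Longrightarrow> \<psi> (\<omega> \<otimes>\<^sub>H \<eta>) = \<phi> \<omega> \<eta>;
          t \<in> Tensor2 C\<rbrakk>
         \<Longrightarrow> \<psi> t = (\<Sum>(a, b)\<in>C \<times> C. \<phi> (t (a, b) \<cdot> E a) (E b))"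
proof -
  define \<psi> where "\<psi> t = (\<Sum>(a, b)\<in>C \<times> C. \<phi> (t (a, b) \<cdot> E a) (E b))" for t
  have "\<psi> (s + t) = \<psi> s + \<psi> t" for s t
  proof -
    have "(s + t) p \<cdot> E a = s p \<cdot> E a + t p \<cdot> E a" for p a
      by (auto simp: lmul_def fun_eq_iff algebra_simps)
    then show ?thesis
      by (auto simp: \<psi>_def sum.distrib[symmetric] lmul_E_Omega1 E_Omega1 addl intro!: sum.cong)
  qed
  moreover have "\<psi> (\<omega> \<otimes>\<^sub>H \<eta>) = \<phi> \<omega> \<eta>" if w: "\<omega> \<in> Omega1 C" and e: "\<eta> \<in> Omega1 C" for \<omega> \<eta>
  proof -
    have z: "0 \<in> Omega1 C" by (simp add: Omega1_def)
    have "(\<omega> \<otimes>\<^sub>H \<eta>) (a, b) \<cdot> E a = rmul (\<omega> a \<cdot> E a) (\<eta> b)" for a b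
      by (auto simp: tensor_def lmul_def rmul_def E_def fun_eq_iff)
    then have "\<psi> (\<omega> \<otimes>\<^sub>H \<eta>) = (\<Sum>(a, b)\<in>C \<times> C. \<phi> (\<omega> a \<cdot> E a) (\<eta> b \<cdot> E b))"
      by (auto simp: \<psi>_def bal lmul_E_Omega1 E_Omega1 intro!: sum.cong)
    also have "\<dots> = (\<Sum>a\<in>C. \<Sum>b\<in>C. \<phi> (\<omega> a \<cdot> E a) (\<eta> b \<cdot> E b))"
      by (simp add: sum.cartesian_product)
    also have "\<dots> = (\<Sum>a\<in>C. \<phi> (\<omega> a \<cdot> E a) \<eta>)"
    proof (rule sum.cong)
      fix a assume a: "a \<in> C"
      have "\<phi> (\<omega> a \<cdot> E a) (\<Sum>b\<in>C. \<eta> b \<cdot> E b) = (\<Sum>b\<in>C. \<phi> (\<omega> a \<cdot> E a) (\<eta> b \<cdot> E b))"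
        by (rule additive_on_sum[where S = "Omega1 C"])
          (blast intro: addr a lmul_E_Omega1 Omega1_add z)+
      then show "(\<Sum>b\<in>C. \<phi> (\<omega> a \<cdot> E a) (\<eta> b \<cdot> E b)) = \<phi> (\<omega> a \<cdot> E a) \<eta>"
        using form1_basis[OF fin e] by simp
    qed simp
    also have "\<dots> = \<phi> (\<Sum>a\<in>C. \<omega> a \<cdot> E a) \<eta>"
      by (rule additive_on_sum[where S = "Omega1 C" and F = "\<lambda>x. \<phi> x \<eta>", symmetric])
        (blast intro: addl e lmul_E_Omega1 Omega1_add z)+
    finally show ?thesis using form1_basis[OF fin w] by simp
  qed
  ultimately show ?ex by blast
next
  fix \<psi> :: "tens \<Rightarrow> 'm" and t
  assume add: "\<And>s t. \<lbrakk>s \<in> Tensor2 C; t \<in> Tensor2 C\<rbrakk> \<Longrightarrow> \<psi> (s + t) = \<psi> s + \<psi> t"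
    and ext: "\<And>\<omega> \<eta>. \<lbrakk>\<omega> \<in> Omega1 C; \<eta> \<in> Omega1 C\<rbrakk> \<Longrightarrow> \<psi> (\<omega> \<otimes>\<^sub>H \<eta>) = \<phi> \<omega> \<eta>"
    and t: "t \<in> Tensor2 C"
  have "\<psi> (\<Sum>p\<in>C \<times> C. case p of (a, b) \<Rightarrow> (t (a, b) \<cdot> E a) \<otimes>\<^sub>H E b)
      = (\<Sum>p\<in>C \<times> C. \<psi> (case p of (a, b) \<Rightarrow> (t (a, b) \<cdot> E a) \<otimes>\<^sub>H E b))"
    by (rule additive_on_sum[where S = "Tensor2 C"])
      (blast intro: add Tensor2_add zero_Tensor2,
       blast intro: add Tensor2_add zero_Tensor2,
       rule zero_Tensor2,
       auto intro!: tensor_Tensor2 lmul_E_Omega1 E_Omega1)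
  also have "\<dots> = (\<Sum>(a, b)\<in>C \<times> C. \<phi> (t (a, b) \<cdot> E a) (E b))"
    by (auto simp: ext lmul_E_Omega1 E_Omega1 intro!: sum.cong)
  finally show "\<psi> t = (\<Sum>(a, b)\<in>C \<times> C. \<phi> (t (a, b) \<cdot> E a) (E b))"
    using tensor_basis[OF fin t] by simp
qed

lemma Psi_add: "Psi C (s + t) = Psi C s + Psi C t"
  by (auto simp: Psi_def lmul_def sum_fun_apply fun_eq_iff algebra_simps
      sum.distrib[symmetric] intro!: sum.cong)

lemma Psi_diff: "Psi C (s - t) = Psi C s - Psi C t"
  using Psi_add[of C "s - t" t] by (simp add: algebra_simps)

lemma ker_add:
  "s \<in> ker_id_minus_Psi C \<Longrightarrow> t \<in> ker_id_minus_Psi C \<Longrightarrow> s + t \<in> ker_id_minus_Psi C"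
  by (simp add: ker_id_minus_Psi_def Psi_add Tensor2_add)

lemma ker_diff:
  "s \<in> ker_id_minus_Psi C \<Longrightarrow> t \<in> ker_id_minus_Psi C \<Longrightarrow> s - t \<in> ker_id_minus_Psi C"
  by (auto simp: ker_id_minus_Psi_def Psi_diff Tensor2_def)

lemma zero_ker: "0 \<in> ker_id_minus_Psi C"
  using Psi_diff[of C 0 0] by (simp add: ker_id_minus_Psi_def Tensor2_def)

lemma class2_coset:
  assumes "t \<in> Tensor2 C"
  shows "class2 C t = {t + k | k. k \<in> ker_id_minus_Psi C}"
proof (intro set_eqI iffI)
  fix s assume "s \<in> class2 C t"
  then have "t - s \<in> ker_id_minus_Psi C" by (simp add: class2_def rel2_def)
  from ker_diff[OF zero_ker this] have "s - t \<in> ker_id_minus_Psi C" by simp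
  moreover have "s = t + (s - t)" by simp
  ultimately show "s \<in> {t + k | k. k \<in> ker_id_minus_Psi C}" by blast
next
  fix s assume "s \<in> {t + k | k. k \<in> ker_id_minus_Psi C}"
  then obtain k where k: "k \<in> ker_id_minus_Psi C" "s = t + k" by blast
  have "t - s = 0 - k" using k by simp
  then have "t - s \<in> ker_id_minus_Psi C" using ker_diff[OF zero_ker k(1)] by simp
  moreover have "s \<in> Tensor2 C"
    using k assms by (auto simp: ker_id_minus_Psi_def Tensor2_add)
  ultimately show "s \<in> class2 C t" using assms by (simp add: class2_def rel2_def)
qed

lemma zero2_eq_ker: "zero2 C = ker_id_minus_Psi C"
  unfolding zero2_def by (subst class2_coset) (auto simp: Tensor2_def)

lemma class2_add:
  assumes "s \<in> Tensor2 C" "t \<in> Tensor2 C"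
  shows "class2 C s + class2 C t = class2 C (s + t)"
proof -
  have "class2 C (s + t) \<subseteq> class2 C s + class2 C t"
  proof
    fix x assume "x \<in> class2 C (s + t)"
    then obtain k where k: "k \<in> ker_id_minus_Psi C" "x = (s + t) + k"
      using class2_coset[OF Tensor2_add[OF assms]] by blast
    have "s + k \<in> class2 C s" "t + 0 \<in> class2 C t"
      using k zero_ker by (auto simp only: class2_coset assms)
    from set_plus_intro[OF this] show "x \<in> class2 C s + class2 C t"
      using k by (simp add: algebra_simps)
  qed
  moreover have "class2 C s + class2 C t \<subseteq> class2 C (s + t)"
  proof
    fix x assume "x \<in> class2 C s + class2 C t"
    then obtain k l where kl: "k \<in> ker_id_minus_Psi C" "l \<in> ker_id_minus_Psi C"
      "x = (s + k) + (t + l)"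
      by (auto simp: class2_coset assms elim!: set_plus_elim)
    have "x = (s + t) + (k + l)" using kl by (simp add: algebra_simps)
    then show "x \<in> class2 C (s + t)"
      using ker_add[OF kl(1,2)] class2_coset[OF Tensor2_add[OF assms]] by blast
  qed
  ultimately show ?thesis by blast
qed

lemma class2_sum:
  assumes "finite I" "I \<noteq> {}" "\<And>i. i \<in> I \<Longrightarrow> t i \<in> Tensor2 C"
  shows "(\<Sum>i\<in>I. class2 C (t i)) = class2 C (\<Sum>i\<in>I. t i)"
proof -
  from assms have "(\<Sum>i\<in>I. t i) \<in> Tensor2 C
      \<and> (\<Sum>i\<in>I. class2 C (t i)) = class2 C (\<Sum>i\<in>I. t i)"
    by (induction I rule: finite_ne_induct) (auto simp: class2_add Tensor2_add)
  then show ?thesis ..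
qed

lemma d1_E:
  assumes "finite C" "a \<in> C"
  shows "d1 C (E a) = (\<Sum>b\<in>C. wedge C (E a) (E b) + wedge C (E b) (E a))"
proof -
  have "d0 C (E a c) = 0" for c
    by (auto simp: d0_def E_def R_def lmul_def fun_eq_iff sum_fun_apply)
  then have "d1 C (E a)
      = class2 C (\<Sum>c\<in>C. E a c \<cdot> (\<Sum>b\<in>C. E c \<otimes>\<^sub>H E b + E b \<otimes>\<^sub>H E c))"
    by (auto simp: d1_def tensor_def fun_eq_iff sum_fun_apply lmul_def
        intro!: arg_cong[where f = "class2 C"])
  also have "(\<Sum>c\<in>C. E a c \<cdot> (\<Sum>b\<in>C. E c \<otimes>\<^sub>H E b + E b \<otimes>\<^sub>H E c))
      = (\<Sum>c\<in>C. if c = a then (\<Sum>b\<in>C. E a \<otimes>\<^sub>H E b + E b \<otimes>\<^sub>H E a) else 0)"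
    by (rule sum.cong) (auto simp: E_def[of a] lmul_def fun_eq_iff)
  also have "\<dots> = (\<Sum>b\<in>C. E a \<otimes>\<^sub>H E b + E b \<otimes>\<^sub>H E a)"
    using assms by simp
  also have "class2 C \<dots> = (\<Sum>b\<in>C. class2 C (E a \<otimes>\<^sub>H E b + E b \<otimes>\<^sub>H E a))"
    using assms by (intro class2_sum[symmetric]) (auto intro!: Tensor2_add tensor_Tensor2 E_Omega1)
  also have "\<dots> = (\<Sum>b\<in>C. wedge C (E a) (E b) + wedge C (E b) (E a))"
    using assms by (auto simp: wedge_def class2_add tensor_Tensor2 E_Omega1 intro!: sum.cong)
  finally show ?thesis .
qed

end

theory Submission
  imports Defs "HOL-Combinatorics.Permutations"
begin

text \<open>
  A 2-form vanishes iff its representing tensor is fixed by the braiding, that is, iff its coefficients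
  are constant on the orbits of \<open>(a, b) \<mapsto> (aba\<^sup>-\<^sup>1, a)\<close> on \<open>C \<times> C\<close>. The off-diagonal orbits are two
  3-cycles, so zero torsion is a system of twelve linear equations over \<open>H\<close> in the nine
  coefficients of the connection. It has constant scalar coefficients, because \<open>R\<^sub>a\<close> fixes the
  coefficients of \<open>E\<^sub>b\<close>, and its solutions form a free family in two functions. Since the
  group has six elements, this is an affine space of complex dimension twelve.
\<close>

section \<open>Order of the group and generalities on forms\<close>

text \<open>The order is used twice: it separates the words in the generators, and it doubles to the
  dimension 12.\<close>

lemma card_S3: "card (UNIV :: S3 set) = 6"
proof -
  have "bij_betw (Perm.apply :: S3 \<Rightarrow> 3 \<Rightarrow> 3) UNIV {p. p permutes UNIV}"
  proof (rule bij_betwI')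
    fix x y :: S3
    show "(Perm.apply x = Perm.apply y) = (x = y)" by (auto intro: perm_eqI)
  next
    fix x :: S3
    show "Perm.apply x \<in> {p. p permutes UNIV}" using bij_apply[of x] by (auto intro: bij_imp_permutes)
  next
    fix p :: "3 \<Rightarrow> 3" assume "p \<in> {p. p permutes UNIV}"
    then have "bij p" by (simp add: permutes_bij)
    then have "p = Perm.apply (Perm.Perm p)" by (simp add: Perm.Perm_inverse)
    then show "\<exists>x\<in>UNIV. p = Perm.apply x" by blast
  qed
  then have "card (UNIV :: S3 set) = card {p :: 3 \<Rightarrow> 3. p permutes UNIV}"
    by (rule bij_betw_same_card)
  also have "\<dots> = fact (card (UNIV :: 3 set))"
    by (rule card_permutations) auto
  finally show ?thesis by (simp add: fact_numeral)
qed

lemma finite_S3: "finite (UNIV :: S3 set)"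
  using card_S3 card.infinite by fastforce

lemma finite_S3_bool: "finite (UNIV :: (S3 \<times> bool) set)"
  using finite_S3 by (simp add: finite_prod)

lemma Omega1_diff: "\<omega> \<in> Omega1 X \<Longrightarrow> \<eta> \<in> Omega1 X \<Longrightarrow> \<omega> - \<eta> \<in> Omega1 X"
  by (auto simp: Omega1_def)

lemma Tensor2_sum: "(\<And>i. i \<in> I \<Longrightarrow> t i \<in> Tensor2 X) \<Longrightarrow> (\<Sum>i\<in>I. t i) \<in> Tensor2 X"
  by (auto simp: Tensor2_def sum_fun_apply)

lemma class2_eq_zero_iff:
  assumes "t \<in> Tensor2 X"
  shows "class2 X t = zero2 X \<longleftrightarrow> t \<in> ker_id_minus_Psi X"
proof
  assume "class2 X t = zero2 X"
  moreover have "t + 0 \<in> class2 X t" unfolding class2_coset[OF assms] using zero_ker by blast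
  ultimately show "t \<in> ker_id_minus_Psi X" by (simp add: zero2_eq_ker)
next
  assume t: "t \<in> ker_id_minus_Psi X"
  have "k \<in> ker_id_minus_Psi X \<Longrightarrow> k = t + (k - t) \<and> k - t \<in> ker_id_minus_Psi X" for k
    using ker_diff[OF _ t] by simp
  then show "class2 X t = zero2 X"
    unfolding zero2_eq_ker class2_coset[OF assms] using ker_add[OF t] by blast
qed

lemma spin_connection_eqI:
  assumes "A \<in> spin_connections X" "B \<in> spin_connections X"
    and "\<And>a b. a \<in> X \<Longrightarrow> b \<in> X \<Longrightarrow> A a b = B a b"
  shows "A = B"
proof (intro ext)
  fix a b g
  show "A a b g = B a b g"
    using assms by (cases "a \<in> X"; cases "b \<in> X") (auto simp: spin_connections_def Omega1_def)
qed

text \<open>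
  The variable \<open>xy\<close> stands for the \<open>E\<^sub>y\<close>-coefficient of \<open>A\<^sub>x\<close>. The three lines on the left say
  that the torsion vanishes at \<open>u\<close>, \<open>v\<close>, \<open>w\<close>.
\<close>

lemma torsion_system:
  fixes uu uv uw vu vv vw wu wv ww :: "'a::comm_ring_1"
  shows "((1 + wu = vv \<and> vv = 1 - vw - ww \<and> 1 - vv - wv = 1 + vu \<and> 1 + vu = ww)
      \<and> (1 - uu - wu = 1 + uv \<and> 1 + uv = ww \<and> 1 + wv = uu \<and> uu = 1 - uw - ww)
      \<and> (uu = 1 - uv - vv \<and> 1 - uv - vv = 1 + vw \<and> vv = 1 - uu - vu \<and> 1 - uu - vu = 1 + uw))
    \<longleftrightarrow> uu = vw + 1 \<and> vv = uw + 1 \<and> ww = uv + 1 \<and> vu = uv \<and> wu = uw \<and> wv = vw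
      \<and> vw + uw + uv = - 1"
    (is "?L \<longleftrightarrow> ?R")
proof
  assume L: ?L
  then have diag: "uu = 1 + vw" "vv = 1 + uw" "ww = 1 + uv" by metis+
  \<comment> \<open>Each diagonal coefficient is also 1 plus the transposed off-diagonal one, so the
    two off-diagonal ones agree.\<close>
  moreover from L this have "vu = uv" "wu = uw" "wv = vw" by (metis add_left_cancel)+
  moreover have "vw + uw + uv = - 1"
  proof -
    have "1 + vw = 1 - uv - (1 + uw)" using L diag by metis
    then show ?thesis by (simp add: algebra_simps eq_neg_iff_add_eq_0)
  qed
  ultimately show ?R by (simp add: add.commute)
next
  assume R: ?R
  then have eqs: "uu = vw + 1" "vv = uw + 1" "ww = uv + 1" "vu = uv" "wu = uw" "wv = vw"
    and uv: "uv = - 1 - vw - uw"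
    by (auto simp: algebra_simps)
  \<comment> \<open>With everything expressed in \<open>vw\<close> and \<open>uw\<close>, each
    equation becomes a ring identity.\<close>
  show ?L unfolding eqs uv by (simp add: algebra_simps)
qed

section \<open>Words and conjugation in the group\<close>

text \<open>\<open>w\<close> is a parameter tied to \<open>u * v * u\<close> by an equation, so that
  it stays an atom when products are reassociated.\<close>

locale S3_calculus =
  fixes u v w :: S3
  assumes u_square: "u * u = 1" and v_square: "v * v = 1" and braid: "u * v * u = v * u * v"
    and generates: "generates_S3 {u, v}" and w_eq: "w = u * v * u"
begin

lemma inverse_gens: "inverse u = u" "inverse v = v" "inverse w = w"
  using perm_mult_inverse_cancel(2)[of u u] perm_mult_inverse_cancel(2)[of v v] u_square v_square
  by (auto simp: w_eq mult.assoc)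

lemma square_cancel: "u * (u * x) = x" "v * (v * x) = x"
  using u_square v_square by (simp_all add: mult.assoc[symmetric])

text \<open>Oriented for rewriting: with squares cancelled and products associated to the right,
  only the six words of \<open>UNIV_words\<close> are irreducible. The second form treats
  \<open>v * u * v\<close> as a prefix of a longer word.\<close>

lemma braid_normalize: "v * (u * v) = u * (v * u)" "v * (u * (v * x)) = u * (v * (u * x))"
  using braid by (metis mult.assoc)+

lemmas word_simps = square_cancel braid_normalize u_square v_square mult.assoc

lemma conjugation:
  "inverse u * u * u = u" "inverse u * v * u = w" "inverse u * w * u = v"
  "inverse v * u * v = w" "inverse v * v * v = v" "inverse v * w * v = u"
  "inverse w * u * w = v" "inverse w * v * w = u" "inverse w * w * w = w"
  "u * u * inverse u = u" "u * v * inverse u = w" "u * w * inverse u = v"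
  "v * u * inverse v = w" "v * v * inverse v = v" "v * w * inverse v = u"
  "w * u * inverse w = v" "w * v * inverse w = u" "w * w * inverse w = w"
  unfolding inverse_gens by (simp_all add: w_eq word_simps)

lemma UNIV_words: "(UNIV :: S3 set) = {1, u, v, u * v, v * u, u * v * u}"
proof -
  have "is_subgroup {1, u, v, u * v, v * u, u * v * u}" (is "is_subgroup ?K")
    unfolding is_subgroup_def
    by (auto simp: inverse_gens word_simps)
  then have "is_subgroup hull {u, v} \<subseteq> ?K" by (intro hull_minimal) auto
  then show ?thesis using generates by (auto simp only: generates_S3_def)
qed

text \<open>Six words exhaust a group of order six, so no two of them coincide.\<close>

lemma gens_distinct: "u \<noteq> v" "u \<noteq> w" "v \<noteq> w" "v \<noteq> u" "w \<noteq> u" "w \<noteq> v"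
proof -
  have "card (set [1, u, v, u * v, v * u, w]) = length [1, u, v, u * v, v * u, w]"
    using card_S3 UNIV_words by (simp add: w_eq)
  then have "distinct [1, u, v, u * v, v * u, w]" by (rule card_distinct)
  then show "u \<noteq> v" "u \<noteq> w" "v \<noteq> w" "v \<noteq> u" "w \<noteq> u" "w \<noteq> v" by auto
qed

abbreviation C :: "S3 set" where "C \<equiv> {u, v, w}"

lemma conj_closed: "a \<in> C \<Longrightarrow> b \<in> C \<Longrightarrow> inverse b * a * b \<in> C"
  by (elim insertE emptyE; simp only: conjugation; simp)

section \<open>A tensor representing the torsion\<close>

definition torsion_tensor :: "(S3 \<Rightarrow> form1) \<Rightarrow> S3 \<Rightarrow> tens" where
  "torsion_tensor A a = (\<Sum>b\<in>C. E a \<otimes>\<^sub>H E b + E b \<otimes>\<^sub>H E a)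
     + (\<Sum>b\<in>C. A b \<otimes>\<^sub>H (E (inverse b * a * b) - E a))"

text \<open>Cosets add elementwise, so a sum of classes over the nonempty set \<open>C\<close> is
  the class of the sum. An empty sum would be \<open>{0}\<close> and not the zero coset.\<close>

lemma torsion_class:
  assumes "A \<in> spin_connections C" "a \<in> C"
  shows "torsion_tensor A a \<in> Tensor2 C" "torsion C A a = class2 C (torsion_tensor A a)"
proof -
  have 1: "E a \<otimes>\<^sub>H E b + E b \<otimes>\<^sub>H E a \<in> Tensor2 C" if "b \<in> C" for b
    using assms that by (intro Tensor2_add tensor_Tensor2 E_Omega1)
  have 2: "A b \<otimes>\<^sub>H (E (inverse b * a * b) - E a) \<in> Tensor2 C" if "b \<in> C" for b
    using assms that unfolding spin_connections_def
    by (intro tensor_Tensor2 Omega1_diff E_Omega1 conj_closed) blast+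
  show "torsion_tensor A a \<in> Tensor2 C"
    unfolding torsion_tensor_def by (intro Tensor2_add Tensor2_sum 1 2)
  have "d1 C (E a) = (\<Sum>b\<in>C. class2 C (E a \<otimes>\<^sub>H E b + E b \<otimes>\<^sub>H E a))"
    unfolding d1_E[OF _ assms(2), simplified finite_insert finite.emptyI, OF TrueI] wedge_def
    using assms
    by (intro sum.cong refl class2_add tensor_Tensor2 E_Omega1)
  then have "d1 C (E a) = class2 C (\<Sum>b\<in>C. E a \<otimes>\<^sub>H E b + E b \<otimes>\<^sub>H E a)"
    using class2_sum[of C, OF _ _ 1] by simp
  moreover have "(\<Sum>b\<in>C. wedge C (A b) (E (inverse b * a * b) - E a))
      = class2 C (\<Sum>b\<in>C. A b \<otimes>\<^sub>H (E (inverse b * a * b) - E a))"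
    unfolding wedge_def by (intro class2_sum 2) auto
  ultimately show "torsion C A a = class2 C (torsion_tensor A a)"
    unfolding torsion_def torsion_tensor_def
    by (simp only: class2_add[OF Tensor2_sum[OF 1] Tensor2_sum[OF 2]])
qed

section \<open>The kernel of id - Psi\<close>

text \<open>The braiding permutes the basis tensors, and \<open>(d, inverse d * c * d)\<close> is
  the only index that it sends to \<open>(c, d)\<close>.\<close>

lemma Psi_apply:
  assumes "c \<in> C" "d \<in> C"
  shows "Psi C t (c, d) = t (d, inverse d * c * d)"
proof -
  have "Psi C t (c, d) = (\<Sum>p\<in>C \<times> C. if p = (d, inverse d * c * d) then t p else 0)"
    unfolding Psi_def sum_fun_apply[where x = "(c, d)"]
  proof (intro sum.cong refl, clarify)
    fix a b
    have "a * b * inverse a = c \<longleftrightarrow> b = inverse a * c * a"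
      by (auto simp: mult.assoc)
    then show "(t (a, b) \<cdot> (E (a * b * inverse a) \<otimes>\<^sub>H E a)) (c, d)
        = (if (a, b) = (d, inverse d * c * d) then t (a, b) else 0)"
      by (auto simp: lmul_def tensor_def E_def R_def fun_eq_iff)
  qed
  also have "\<dots> = t (d, inverse d * c * d)"
    using assms conj_closed[OF assms]
    by (simp only: sum.delta finite_cartesian_product finite.intros mem_Sigma_iff if_True simp_thms)
  finally show ?thesis .
qed

lemma Psi_Tensor2: "Psi C t \<in> Tensor2 C"
proof -
  have "t p \<cdot> (E (a * b * inverse a) \<otimes>\<^sub>H E a) \<in> Tensor2 C" if "a \<in> C" "b \<in> C" for a b p
  proof -
    have "a * b * inverse a \<in> C" using that
      by (elim insertE emptyE; simp only: conjugation; simp)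
    from tensor_Tensor2[OF E_Omega1[OF this] E_Omega1[OF that(1)]]
    show ?thesis by (auto simp: Tensor2_def lmul_def)
  qed
  then show ?thesis unfolding Psi_def by (intro Tensor2_sum) auto
qed

text \<open>Diagonal pairs are fixed and impose nothing. The cycles are (u,v), (v,w), (w,u) and
  (v,u), (u,w), (w,v); two equalities make \<open>t\<close> constant on each.\<close>

lemma ker_iff:
  assumes "t \<in> Tensor2 C"
  shows "t \<in> ker_id_minus_Psi C \<longleftrightarrow>
    t (u, v) = t (v, w) \<and> t (v, w) = t (w, u) \<and> t (v, u) = t (u, w) \<and> t (u, w) = t (w, v)"
proof -
  have "t \<in> ker_id_minus_Psi C \<longleftrightarrow> (\<forall>p. t p = Psi C t p)"
    using assms by (simp add: ker_id_minus_Psi_def fun_eq_iff)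
  also have "\<dots> \<longleftrightarrow> (\<forall>c\<in>C. \<forall>d\<in>C. t (c, d) = Psi C t (c, d))"
  proof -
    \<comment> \<open>Off \<open>C \<times> C\<close> both sides vanish.\<close>
    have "t p = Psi C t p" if "p \<notin> C \<times> C" for p
      using assms Psi_Tensor2[of t] that unfolding Tensor2_def mem_Collect_eq by metis
    then have "t p = Psi C t p" if "\<forall>c\<in>C. \<forall>d\<in>C. t (c, d) = Psi C t (c, d)" for p
      using that by (cases "p \<in> C \<times> C") (blast, blast)
    then show ?thesis by (intro iffI allI ballI) (rule spec, assumption, assumption)
  qed
  also have "\<dots> \<longleftrightarrow> (\<forall>c\<in>C. \<forall>d\<in>C. t (c, d) = t (d, inverse d * c * d))"
    by (intro ball_cong refl) (simp only: Psi_apply)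
  also have "\<dots> \<longleftrightarrow>
    t (u, v) = t (v, w) \<and> t (v, w) = t (w, u) \<and> t (v, u) = t (u, w) \<and> t (u, w) = t (w, v)"
    unfolding ball_simps conjugation by (rule iffI; elim conjE; intro conjI TrueI refl; metis)
  finally show ?thesis .
qed

section \<open>The torsion equations in coordinates\<close>

lemma torsion_tensor_apply:
  "torsion_tensor A a (c, d) = (\<Sum>b\<in>C. E a c * E b d + E b c * E a d)
     + (\<Sum>b\<in>C. A b c * (E (inverse b * a * b) d - E a d))"
proof -
  have "R c (E x y) = E x y" for x y by (auto simp: R_def E_def)
  moreover have "R c (f - g) = R c f - R c g" for f g by (auto simp: R_def)
  ultimately show ?thesis
    by (simp only: torsion_tensor_def tensor_def plus_fun_apply sum_fun_apply prod.case minus_apply)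
qed

lemma sum_C: "(\<Sum>a\<in>C. f a) = f u + f v + f w"
  for f :: "S3 \<Rightarrow> 'a::comm_monoid_add"
  by (simp add: gens_distinct add.assoc)

text \<open>The 1 comes from the derivative of \<open>E a\<close>, at the pairs containing
  \<open>a\<close>. If the second index is \<open>a\<close>, two coefficients enter negatively;
  otherwise one enters positively, from the \<open>b\<close> that conjugates \<open>a\<close> to
  that index.\<close>

lemma torsion_tensor_values:
  "torsion_tensor A u (u, v) = 1 + A w u"
  "torsion_tensor A u (v, w) = A v v"
  "torsion_tensor A u (w, u) = 1 - A v w - A w w"
  "torsion_tensor A u (v, u) = 1 - A v v - A w v"
  "torsion_tensor A u (u, w) = 1 + A v u"
  "torsion_tensor A u (w, v) = A w w"
  "torsion_tensor A v (u, v) = 1 - A u u - A w u"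
  "torsion_tensor A v (v, w) = 1 + A u v"
  "torsion_tensor A v (w, u) = A w w"
  "torsion_tensor A v (v, u) = 1 + A w v"
  "torsion_tensor A v (u, w) = A u u"
  "torsion_tensor A v (w, v) = 1 - A u w - A w w"
  "torsion_tensor A w (u, v) = A u u"
  "torsion_tensor A w (v, w) = 1 - A u v - A v v"
  "torsion_tensor A w (w, u) = 1 + A v w"
  "torsion_tensor A w (v, u) = A v v"
  "torsion_tensor A w (u, w) = 1 - A u u - A v u"
  "torsion_tensor A w (w, v) = 1 + A u w"
  unfolding torsion_tensor_apply sum_C conjugation by (simp_all add: E_def gens_distinct)

lemma zero_torsion_iff:
  assumes A: "A \<in> spin_connections C"
  shows "zero_torsion C A \<longleftrightarrow>
    A u u = A v w + 1 \<and> A v v = A u w + 1 \<and> A w w = A u v + 1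
    \<and> A v u = A u v \<and> A w u = A u w \<and> A w v = A v w
    \<and> A v w + A u w + A u v = - 1"
proof -
  have "zero_torsion C A \<longleftrightarrow> (\<forall>a\<in>C. torsion_tensor A a \<in> ker_id_minus_Psi C)"
    unfolding zero_torsion_def using torsion_class[OF A]
    by (intro ball_cong refl) (simp only: class2_eq_zero_iff)
  also have "\<dots> \<longleftrightarrow> (\<forall>a\<in>C. let t = torsion_tensor A a in
    t (u, v) = t (v, w) \<and> t (v, w) = t (w, u) \<and> t (v, u) = t (u, w) \<and> t (u, w) = t (w, v))"
    unfolding Let_def using torsion_class(1)[OF A]
    by (intro ball_cong refl) (simp only: ker_iff)
  also have "\<dots> \<longleftrightarrow>
    A u u = A v w + 1 \<and> A v v = A u w + 1 \<and> A w w = A u v + 1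
    \<and> A v u = A u v \<and> A w u = A u w \<and> A w v = A v w
    \<and> A v w + A u w + A u v = - 1"
    unfolding Let_def ball_simps torsion_tensor_values simp_thms
    by (rule torsion_system)
  finally show ?thesis .
qed

section \<open>Dimension of the moduli space\<close>

text \<open>
  The direction space of the affine moduli space; \<open>coord\<close> and \<open>basis_connection\<close> are dual
  to each other.
\<close>

definition linear_connections :: "(S3 \<Rightarrow> form1) set" where
  "linear_connections = {A \<in> spin_connections C. A v w = A u u \<and> A w v = A u u
     \<and> A v v = A u w \<and> A w u = A u w \<and> A v u = A u v \<and> A w w = A u v \<and> A u u + A u w + A u v = 0}"

definition coord :: "(S3 \<Rightarrow> form1) \<Rightarrow> S3 \<times> bool \<Rightarrow> complex" where
  "coord A = (\<lambda>(g, i). if i then A u u g else A u w g)"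

definition basis_connection :: "S3 \<times> bool \<Rightarrow> S3 \<Rightarrow> form1" where
  "basis_connection = (\<lambda>(h, i) a b g.
     if g = h \<and> a \<in> C \<and> b \<in> C then
       if (a, b) \<in> {(u, u), (v, w), (w, v)} then of_bool i
       else if (a, b) \<in> {(u, w), (v, v), (w, u)} then of_bool (\<not> i)
       else - 1
     else 0)"

lemma subspace_linear_connections: "conn.subspace linear_connections"
  by (rule conn.subspaceI)
    (auto simp: linear_connections_def spin_connections_def Omega1_def scaleC_conn_def fun_eq_iff
      algebra_simps simp flip: distrib_left)

text \<open>The coordinates are two entries of row \<open>u\<close>. The zero-sum relation gives the
  third, and the other rows repeat these three functions.\<close>

lemma coord_inject:
  assumes "A \<in> linear_connections" "B \<in> linear_connections" "coord A = coord B"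
  shows "A = B"
proof (rule spin_connection_eqI)
  have "A u u = B u u" "A u w = B u w"
    using fun_cong[OF assms(3), of "(_, True)"] fun_cong[OF assms(3), of "(_, False)"]
    by (auto simp: coord_def)
  moreover from this have "A u v = B u v"
    using assms(1,2) unfolding linear_connections_def mem_Collect_eq
    by (metis add_left_imp_eq)
  ultimately show "A a b = B a b" if "a \<in> C" "b \<in> C" for a b
    using that assms(1,2) unfolding linear_connections_def by auto
qed (use assms in \<open>auto simp: linear_connections_def\<close>)

text \<open>At \<open>h\<close>, exactly one of the first two classes of entries has value 1, so the
  third class needs -1 for the sum to vanish.\<close>

lemma basis_connection_linear: "basis_connection p \<in> linear_connections"
  by (auto simp: basis_connection_def linear_connections_def spin_connections_def Omega1_def
      gens_distinct fun_eq_iff split: prod.splits)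

lemma coord_basis: "coord (basis_connection p) q = of_bool (p = q)"
  by (auto simp: coord_def basis_connection_def gens_distinct split: prod.splits)

lemma coord_sum: "coord (\<Sum>p\<in>I. scaleC_conn (f p) (A p)) q = (\<Sum>p\<in>I. f p * coord (A p) q)"
  by (auto simp: coord_def scaleC_conn_def sum_fun_apply split: prod.splits)

text \<open>By duality a combination returns its own coefficients. This yields spanning, through
  \<open>coord_inject\<close>, and independence.\<close>

lemma coord_combination: "coord (\<Sum>p\<in>UNIV. scaleC_conn (f p) (basis_connection p)) = f"
  by (rule ext) (simp add: coord_sum coord_basis finite_S3_bool of_bool_def if_distrib cong: if_cong)

lemma inj_basis_connection: "inj basis_connection"
proof (rule injI)
  fix p q assume "basis_connection p = basis_connection q"
  then have "coord (basis_connection p) q = coord (basis_connection q) q" by simp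
  then show "p = q" by (simp add: coord_basis split: if_splits)
qed

lemma dim_linear_connections: "conn.dim linear_connections = 12"
proof (rule conn.dim_unique)
  show "range basis_connection \<subseteq> linear_connections" using basis_connection_linear by blast
  show "linear_connections \<subseteq> conn.span (range basis_connection)"
  proof
    fix A assume A: "A \<in> linear_connections"
    let ?S = "\<Sum>p\<in>UNIV. scaleC_conn (coord A p) (basis_connection p)"
    have "?S \<in> linear_connections"
      by (intro conn.subspace_sum conn.subspace_scale subspace_linear_connections
          basis_connection_linear)
    then have "A = ?S" by (rule coord_inject[OF A]) (simp add: coord_combination)
    also have "?S \<in> conn.span (range basis_connection)"
      by (intro conn.span_sum conn.span_scale conn.span_base) simp
    finally show "A \<in> conn.span (range basis_connection)" .
  qed
  show "conn.independent (range basis_connection)"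
  proof (rule conn.independent_if_scalars_zero)
    show "finite (range basis_connection)" using finite_S3_bool by (rule finite_imageI)
    fix f A
    assume sum: "(\<Sum>A\<in>range basis_connection. scaleC_conn (f A) A) = 0"
      and A: "A \<in> range basis_connection"
    have "(\<Sum>p\<in>UNIV. scaleC_conn (f (basis_connection p)) (basis_connection p)) = 0"
      using sum by (simp add: sum.reindex[OF inj_basis_connection])
    then have "(\<lambda>p. f (basis_connection p)) = coord 0"
      using coord_combination[of "\<lambda>p. f (basis_connection p)"] by simp
    then show "f A = 0" using A by (auto simp: coord_def fun_eq_iff)
  qed
  show "card (range basis_connection) = 12"
    using card_image[OF inj_basis_connection] card_S3
    by (simp add: card_cartesian_product flip: UNIV_Times_UNIV)
qed

lemma torsion_free_eq_translate:
  "\<exists>P. torsion_free_connections C = {P + A | A. A \<in> linear_connections}"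
proof -
  \<comment> \<open>the member \<open>\<alpha> = -1\<close>, \<open>\<beta> = \<gamma> = 0\<close> of the family\<close>
  define P :: "S3 \<Rightarrow> form1" where "P = (\<lambda>a b g.
     if (a, b) \<in> {(v, w), (w, v)} then - 1 else if (a, b) \<in> {(v, v), (w, w)} then 1 else 0)"
  have P: "P \<in> spin_connections C"
    by (auto simp: P_def spin_connections_def Omega1_def fun_eq_iff)
  have Pv: "P u u = 0" "P u v = 0" "P u w = 0" "P v u = 0" "P v v = 1" "P v w = - 1"
    "P w u = 0" "P w v = - 1" "P w w = 1"
    by (auto simp: P_def gens_distinct fun_eq_iff)
  \<comment> \<open>The values of \<open>P\<close> absorb the constants of the affine system,
    leaving the homogeneous relations for \<open>A\<close>.\<close>
  have *: "P + A \<in> torsion_free_connections C \<longleftrightarrow> A \<in> linear_connections" for A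
  proof -
    have "P + A \<in> spin_connections C \<longleftrightarrow> A \<in> spin_connections C"
      using P by (auto simp: spin_connections_def Omega1_def)
    then show ?thesis
      unfolding torsion_free_connections_def linear_connections_def mem_Collect_eq
      using zero_torsion_iff[of "P + A"]
      by (auto simp: Pv algebra_simps)
  qed
  show ?thesis
  proof (intro exI set_eqI)
    fix B
    show "B \<in> torsion_free_connections C \<longleftrightarrow> B \<in> {P + A | A. A \<in> linear_connections}"
    proof
      assume B: "B \<in> torsion_free_connections C"
      have "B = P + (B - P)" by simp
      moreover from this have "B - P \<in> linear_connections" using B * by metis
      ultimately show "B \<in> {P + A | A. A \<in> linear_connections}" by blast
    qed (use * in blast)
  qed
qed

lemma complex_affine_dim_torsion_free: "complex_affine_dim (torsion_free_connections C) 12"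
  unfolding complex_affine_dim_def
  using torsion_free_eq_translate subspace_linear_connections dim_linear_connections by blast

section \<open>The explicit family and its sum\<close>

lemma form1_eq_iff:
  assumes "\<omega> \<in> Omega1 C"
  shows "\<omega> = f \<cdot> E u + g \<cdot> E v + h \<cdot> E w \<longleftrightarrow> \<omega> u = f \<and> \<omega> v = g \<and> \<omega> w = h"
proof -
  have "\<omega> = \<omega> u \<cdot> E u + \<omega> v \<cdot> E v + \<omega> w \<cdot> E w"
    using form1_basis[OF _ assms] by (simp add: gens_distinct add.assoc)
  moreover have "(f \<cdot> E u + g \<cdot> E v + h \<cdot> E w) u = f" "(f \<cdot> E u + g \<cdot> E v + h \<cdot> E w) v = g"
    "(f \<cdot> E u + g \<cdot> E v + h \<cdot> E w) w = h"
    by (simp_all add: lmul_def E_def gens_distinct)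
  ultimately show ?thesis by metis
qed

lemma torsion_free_eq_family:
  "torsion_free_connections C =
      {A \<in> spin_connections C. \<exists>\<alpha> \<beta> \<gamma> :: H. \<alpha> + \<beta> + \<gamma> = -1 \<and>
         A u = (\<alpha> + 1) \<cdot> E u + \<gamma> \<cdot> E v + \<beta> \<cdot> E w \<and>
         A v = \<gamma> \<cdot> E u + (\<beta> + 1) \<cdot> E v + \<alpha> \<cdot> E w \<and>
         A w = \<beta> \<cdot> E u + \<alpha> \<cdot> E v + (\<gamma> + 1) \<cdot> E w}"
proof -
  have "zero_torsion C A \<longleftrightarrow> (\<exists>\<alpha> \<beta> \<gamma> :: H. \<alpha> + \<beta> + \<gamma> = -1 \<and>
         A u = (\<alpha> + 1) \<cdot> E u + \<gamma> \<cdot> E v + \<beta> \<cdot> E w \<and>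
         A v = \<gamma> \<cdot> E u + (\<beta> + 1) \<cdot> E v + \<alpha> \<cdot> E w \<and>
         A w = \<beta> \<cdot> E u + \<alpha> \<cdot> E v + (\<gamma> + 1) \<cdot> E w)"
    if A: "A \<in> spin_connections C" for A
  proof -
    have "A u \<in> Omega1 C" "A v \<in> Omega1 C" "A w \<in> Omega1 C"
      using A by (auto simp: spin_connections_def)
    note eqs = this[THEN form1_eq_iff]
    show ?thesis
      unfolding zero_torsion_iff[OF A] eqs
    proof (intro iffI; elim exE conjE)
      assume "A u u = A v w + 1" "A v v = A u w + 1" "A w w = A u v + 1"
        "A v u = A u v" "A w u = A u w" "A w v = A v w" "A v w + A u w + A u v = - 1"
      then show "\<exists>\<alpha> \<beta> \<gamma> :: H. \<alpha> + \<beta> + \<gamma> = -1 \<and>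
        (A u u = \<alpha> + 1 \<and> A u v = \<gamma> \<and> A u w = \<beta>) \<and>
        (A v u = \<gamma> \<and> A v v = \<beta> + 1 \<and> A v w = \<alpha>) \<and>
        A w u = \<beta> \<and> A w v = \<alpha> \<and> A w w = \<gamma> + 1"
        \<comment> \<open>The witnesses are forced: they are the entries of the family that carry no
          added 1.\<close>
        by (intro exI[of _ "A v w"] exI[of _ "A u w"] exI[of _ "A u v"]) simp
    qed (intro conjI; simp)
  qed
  then show ?thesis
    unfolding torsion_free_connections_def by (intro Collect_cong conj_cong refl)
qed

text \<open>Each column of coefficients contains \<alpha>, \<beta> and \<gamma> once and one added
  1, so it sums to \<alpha> + \<beta> + \<gamma> + 1 = 0.\<close>

lemma sum_torsion_free:
  assumes "A \<in> torsion_free_connections C"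
  shows "(\<Sum>a\<in>C. A a) = 0"
proof
  fix b
  have A: "A \<in> spin_connections C" and "zero_torsion C A"
    using assms by (auto simp: torsion_free_connections_def)
  note eqs = this(2)[unfolded zero_torsion_iff[OF A]]
  then have rel: "A v w = - 1 - A u w - A u v" by (simp add: algebra_simps)
  have "(\<Sum>a\<in>C. A a) b = A u b + A v b + A w b"
    by (simp add: gens_distinct add.assoc)
  also have "\<dots> = 0"
  proof (cases "b \<in> C")
    case True
    then show ?thesis using eqs rel by (elim insertE emptyE) simp_all
  next
    case False
    then show ?thesis using A by (simp add: spin_connections_def Omega1_def)
  qed
  finally show "(\<Sum>a\<in>C. A a) b = 0 b" by simp
qed

end

theorem proposition5p7:
  fixes u v :: S3 and C :: "S3 set"
  assumes "u * u = 1" and "v * v = 1" and "u * v * u = v * u * v"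
    and "generates_S3 {u, v}"
    and "C = {u, v, u * v * u}"
  shows "complex_affine_dim (torsion_free_connections C) 12 \<and>
    torsion_free_connections C =
      {A \<in> spin_connections C. \<exists>\<alpha> \<beta> \<gamma> :: H. \<alpha> + \<beta> + \<gamma> = -1 \<and>
         A u = (\<alpha> + 1) \<cdot> E u + \<gamma> \<cdot> E v + \<beta> \<cdot> E (u * v * u) \<and>
         A v = \<gamma> \<cdot> E u + (\<beta> + 1) \<cdot> E v + \<alpha> \<cdot> E (u * v * u) \<and>
         A (u * v * u) = \<beta> \<cdot> E u + \<alpha> \<cdot> E v + (\<gamma> + 1) \<cdot> E (u * v * u)} \<and>
    (\<forall>A \<in> torsion_free_connections C. (\<Sum>a\<in>C. A a) = 0)"
proof -
  interpret S3_calculus u v "u * v * u"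
    using assms by unfold_locales auto
  show ?thesis
    unfolding assms(5)
    by (intro conjI ballI complex_affine_dim_torsion_free torsion_free_eq_family sum_torsion_free)
qed

end
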